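(* Let $\mathbb{A}$ be a unital $C^*$-algebra, let $(X,\mathbb{A},p)$ be a complete $C^*$-algebra valued partial metric space, and let $T:X\to X$ be a mapping for which there is a real number $k\in(0,1)$ such that $$p(Tx,Ty)\preceq k\,p(x,y)\quad\text{for all }x,y\in X.$$ Then $T$ has a unique fixed point $u\in X$, and $p(u,u)=\theta$.
   Context: $\mathbb{A}$ is a unital $C^*$-algebra with unit $I$ and zero element $\theta$; $\mathbb{A}_+$ is the set of positive elements, and for self-adjoint $a,b$, $a\preceq b$ means $b-a\in\mathbb{A}_+$. A $C^*$-algebra valued partial metric space $(X,\mathbb{A},p)$ is a non-empty set $X$ with $p:X\times X\to\mathbb{A}$ such that for all $x,y,z\in X$: (i) $\theta\preceq p(x,y)$, and $p(x,x)=p(y,y)=p(x,y)$ iff $x=y$; (ii) $p(x,y)=p(y,x)$; (iii) $p(x,x)\preceq p(x,y)$; (iv) $p(x,y)\preceq p(x,z)+p(z,y)-p(z,z)$. A sequence $(x_n)$ converges to $x$ if $\lim_n (p(x_n,x)-p(x,x))=\theta$ in norm. It is partial Cauchy if for every $\varepsilon>0$ there is $N$ such that for all $n,m>N$, $q_{n,m}q_{n,m}^*\preceq\varepsilon^2 I$, where $q_{n,m}=p(x_n,x_m)-\frac12p(x_n,x_n)-\frac12p(x_m,x_m)$. The space is complete if every partial Cauchy sequence $(x_n)$ converges to a point $x\in X$ such that $\lim_n\bigl(p(x_n,x)-\frac12p(x_n,x_n)-\frac12p(x,x)\bigr)=\theta$. *)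

theory Defs
  imports "HOL-Analysis.Analysis"
begin

text \<open>The distribution has no complex algebras with involution, so the complex scalar
  multiplication and the involution are added to the class of real unital Banach algebras,
  whose real scalar multiplication is required to be the restriction of the complex one. The class
  \<^class>\<open>real_normed_algebra_1\<close> entails that the unit has norm one.\<close>

class unital_cstar_algebra = real_normed_algebra_1 + banach +
  fixes scaleC :: "complex \<Rightarrow> 'a \<Rightarrow> 'a"  (infixr \<open>*\<^sub>C\<close> 75)
    and adj :: "'a \<Rightarrow> 'a"
  assumes scaleC_add_right: "c *\<^sub>C (a + b) = c *\<^sub>C a + c *\<^sub>C b"
    and scaleC_add_left: "(c + d) *\<^sub>C a = c *\<^sub>C a + d *\<^sub>C a"
    and scaleC_scaleC: "c *\<^sub>C (d *\<^sub>C a) = (c * d) *\<^sub>C a"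
    and scaleC_of_real: "complex_of_real r *\<^sub>C a = r *\<^sub>R a"
    and mult_scaleC_left: "(c *\<^sub>C a) * b = c *\<^sub>C (a * b)"
    and mult_scaleC_right: "a * (c *\<^sub>C b) = c *\<^sub>C (a * b)"
    and norm_scaleC: "norm (c *\<^sub>C a) = cmod c * norm a"
    and adj_adj: "adj (adj a) = a"
    and adj_add: "adj (a + b) = adj a + adj b"
    and adj_scaleC: "adj (c *\<^sub>C a) = cnj c *\<^sub>C adj a"
    and adj_mult: "adj (a * b) = adj b * adj a"
    and cstar_identity: "norm (adj a * a) = (norm a)\<^sup>2"

definition self_adjoint :: "'a::unital_cstar_algebra \<Rightarrow> bool" where
  "self_adjoint a \<longleftrightarrow> adj a = a"

definition spectrum :: "'a::unital_cstar_algebra \<Rightarrow> complex set" where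
  "spectrum a = {z. \<not> (\<exists>b. (z *\<^sub>C 1 - a) * b = 1 \<and> b * (z *\<^sub>C 1 - a) = 1)}"

definition positive_elements :: "'a::unital_cstar_algebra set" where
  "positive_elements = {a. self_adjoint a \<and> spectrum a \<subseteq> complex_of_real ` {0..}}"

definition cstar_le :: "'a::unital_cstar_algebra \<Rightarrow> 'a \<Rightarrow> bool"  (infix \<open>\<preceq>\<close> 50) where
  "a \<preceq> b \<longleftrightarrow> self_adjoint a \<and> self_adjoint b \<and> b - a \<in> positive_elements"

locale cstar_partial_metric_space =
  fixes X :: "'x set" and p :: "'x \<Rightarrow> 'x \<Rightarrow> 'a::unital_cstar_algebra"
  assumes nonempty: "X \<noteq> {}"
    and nonneg: "\<lbrakk>x \<in> X; y \<in> X\<rbrakk> \<Longrightarrow> 0 \<preceq> p x y"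
    and eq_iff: "\<lbrakk>x \<in> X; y \<in> X\<rbrakk> \<Longrightarrow> (p x x = p y y \<and> p y y = p x y) \<longleftrightarrow> x = y"
    and symmetric: "\<lbrakk>x \<in> X; y \<in> X\<rbrakk> \<Longrightarrow> p x y = p y x"
    and self_le: "\<lbrakk>x \<in> X; y \<in> X\<rbrakk> \<Longrightarrow> p x x \<preceq> p x y"
    and triangle: "\<lbrakk>x \<in> X; y \<in> X; z \<in> X\<rbrakk> \<Longrightarrow> p x y \<preceq> p x z + p z y - p z z"

definition converges_to :: "('x \<Rightarrow> 'x \<Rightarrow> 'a::unital_cstar_algebra) \<Rightarrow> (nat \<Rightarrow> 'x) \<Rightarrow> 'x \<Rightarrow> bool" where
  "converges_to p s x \<longleftrightarrow> (\<lambda>n. p (s n) x - p x x) \<longlonglongrightarrow> 0"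

definition centred :: "('x \<Rightarrow> 'x \<Rightarrow> 'a::unital_cstar_algebra) \<Rightarrow> 'x \<Rightarrow> 'x \<Rightarrow> 'a" where
  "centred p x y = p x y - (1/2) *\<^sub>R p x x - (1/2) *\<^sub>R p y y"

definition partial_Cauchy :: "('x \<Rightarrow> 'x \<Rightarrow> 'a::unital_cstar_algebra) \<Rightarrow> (nat \<Rightarrow> 'x) \<Rightarrow> bool" where
  "partial_Cauchy p s \<longleftrightarrow>
     (\<forall>\<epsilon>>0. \<exists>N. \<forall>n>N. \<forall>m>N.
        centred p (s n) (s m) * adj (centred p (s n) (s m)) \<preceq> \<epsilon>\<^sup>2 *\<^sub>R 1)"

locale complete_cstar_partial_metric_space = cstar_partial_metric_space +
  assumes complete:
    "\<lbrakk>range s \<subseteq> X; partial_Cauchy p s\<rbrakk> \<Longrightarrow>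
       \<exists>x\<in>X. converges_to p s x \<and> (\<lambda>n. centred p (s n) x) \<longlonglongrightarrow> 0"

end

theory Submission
  imports Defs
begin

text \<open>
  The order on a \<open>C\<^sup>*\<close>-algebra enters the fixed point argument through two facts: on positive
  elements the norm is monotone (\<open>norm_mono\<close>), and a self-adjoint element of norm at most \<open>\<epsilon>\<close> has
  square below \<open>\<epsilon>\<^sup>2\<close> (\<open>square_le_if_norm_le\<close>). The first turns the contraction condition and the
  triangle inequality for \<open>p\<close> into the same conditions for the real function
  \<open>d x y = norm (p x y)\<close>; the second turns smallness of \<open>d\<close> along an orbit into the
  order-theoretic Cauchy condition. The rest is Banach's argument for \<open>d\<close>: the orbit
  distances decay geometrically, including the self-distances, so the limit \<open>u\<close> has \<open>p u u = 0\<close>, and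
  \<open>d u (T u)\<close> is a limit of quantities tending to zero. Uniqueness holds because \<open>d u v = 0\<close> forces
  \<open>u = v\<close>.

  Positivity is defined by the spectrum, so both facts rest on the position of the spectrum of a
  self-adjoint element: it is real, and its largest modulus is the norm. Reality follows from the
  \<open>C\<^sup>*\<close>-identity applied to imaginary translates. For the norm, suppose that \<open>norm b = 1\<close> while
  \<open>1 - b * b\<close> is invertible. Then \<open>1 - s\<^sup>2 *\<^sub>R (b * b)\<close> still has a self-adjoint square root for
  some \<open>s > 1\<close>, which exhibits \<open>s *\<^sub>R b\<close> as the real part of a unitary and contradicts
  \<open>norm (s *\<^sub>R b) = s > 1\<close>. The roots come from fixed points of contractions. It follows
  that a self-adjoint \<open>a\<close> with \<open>norm a \<le> t\<close> is positive exactly if \<open>norm (t *\<^sub>R 1 - a) \<le> t\<close>, a condition visibly stable under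
  addition; this makes the positive elements a cone and the norm monotone on it.
\<close>

section \<open>Scalars and the involution\<close>

lemma scaleC_one: "1 *\<^sub>C a = (a::'a::unital_cstar_algebra)"
  using scaleC_of_real[of 1 a] by simp

lemma scaleC_minus_left: "(- c) *\<^sub>C a = - (c *\<^sub>C (a::'a::unital_cstar_algebra))"
proof -
  have "(- c) *\<^sub>C a + c *\<^sub>C a = 0"
    using scaleC_add_left[of "- c" c a] scaleC_of_real[of 0 a] by simp
  then show ?thesis
    by (simp add: eq_neg_iff_add_eq_0)
qed

lemma scaleC_diff_right: "c *\<^sub>C (a - b) = c *\<^sub>C a - c *\<^sub>C (b::'a::unital_cstar_algebra)"
  using scaleC_add_right[of c "a - b" b] by (simp add: eq_diff_eq)

lemma scaleC_scaleR: "c *\<^sub>C (r *\<^sub>R a) = r *\<^sub>R (c *\<^sub>C (a::'a::unital_cstar_algebra))"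
  by (simp add: scaleC_scaleC mult.commute flip: scaleC_of_real)

lemma adj_zero: "adj (0::'a::unital_cstar_algebra) = 0"
  using adj_add[of 0 "0::'a"] by simp

lemma adj_one: "adj (1::'a::unital_cstar_algebra) = 1"
  by (metis adj_adj adj_mult mult.right_neutral)

lemma adj_scaleR: "adj (r *\<^sub>R a) = r *\<^sub>R adj (a::'a::unital_cstar_algebra)"
  using adj_scaleC[of "complex_of_real r" a] by (simp add: scaleC_of_real)

lemma adj_minus: "adj (- a) = - adj (a::'a::unital_cstar_algebra)"
  using adj_scaleR[of "-1" a] by simp

lemma adj_diff: "adj (a - b) = adj a - adj (b::'a::unital_cstar_algebra)"
  using adj_add[of a "- b"] by (simp add: adj_minus)

lemma norm_adj: "norm (adj a) = norm (a::'a::unital_cstar_algebra)"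
proof -
  have le: "norm b \<le> norm (adj b)" for b :: 'a
  proof (cases "b = 0")
    case False
    have "norm b * norm b \<le> norm (adj b) * norm b"
      using cstar_identity[of b] norm_mult_ineq[of "adj b" b] by (simp add: power2_eq_square)
    then show ?thesis
      using False by simp
  qed simp
  show ?thesis
    using le[of a] le[of "adj a"] by (simp add: adj_adj)
qed

lemma bounded_linear_adj: "bounded_linear (adj :: 'a::unital_cstar_algebra \<Rightarrow> 'a)"
  by (rule bounded_linear_intro[where K = 1]) (simp_all add: adj_add adj_scaleR norm_adj)

lemma norm_square_self_adjoint:
  "self_adjoint a \<Longrightarrow> norm (a * a) = (norm (a::'a::unital_cstar_algebra))\<^sup>2"
  using cstar_identity[of a] by (simp add: self_adjoint_def)

lemma self_adjoint_simps [simp]: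
  "self_adjoint (0::'a::unital_cstar_algebra)"
  "self_adjoint (1::'a)"
  "self_adjoint a \<Longrightarrow> self_adjoint b \<Longrightarrow> self_adjoint (a + b :: 'a)"
  "self_adjoint a \<Longrightarrow> self_adjoint b \<Longrightarrow> self_adjoint (a - b :: 'a)"
  "self_adjoint a \<Longrightarrow> self_adjoint (- a :: 'a)"
  "self_adjoint a \<Longrightarrow> self_adjoint (r *\<^sub>R a :: 'a)"
  by (simp_all add: self_adjoint_def adj_zero adj_one adj_add adj_diff adj_minus adj_scaleR)

lemma self_adjoint_mult:
  "self_adjoint a \<Longrightarrow> self_adjoint b \<Longrightarrow> a * b = b * a \<Longrightarrow> self_adjoint (a * b :: 'a::unital_cstar_algebra)"
  by (simp add: self_adjoint_def adj_mult)

lemma norm_isometry_le_one: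
  "adj u * u = 1 \<Longrightarrow> norm (u::'a::unital_cstar_algebra) \<le> 1"
  using cstar_identity[of u] power2_le_imp_le[of "norm u" 1] by simp

lemma inverse_self_adjoint:
  fixes a b :: "'a::unital_cstar_algebra"
  assumes "self_adjoint a" "a * b = 1" "b * a = 1"
  shows "self_adjoint b"
proof -
  have "adj b * a = 1"
    using assms adj_mult[of a b] by (simp add: self_adjoint_def adj_one)
  then have "adj b = adj b * (a * b)"
    using assms by simp
  also have "\<dots> = b"
    using \<open>adj b * a = 1\<close> by (simp flip: mult.assoc)
  finally show ?thesis
    by (simp add: self_adjoint_def)
qed

lemma inverse_commutes:
  fixes a b v :: "'a::unital_cstar_algebra"
  assumes "a * b = 1" "b * a = 1" "v * a = a * v"
  shows "v * b = b * v"
proof -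
  have "v * b = b * (a * v) * b"
    using assms by (simp flip: mult.assoc)
  also have "\<dots> = b * v * (a * b)"
    using assms(3) by (metis mult.assoc)
  finally show ?thesis
    using assms by simp
qed

section \<open>The spectrum of a self-adjoint element\<close>

lemma neumann_inverse:
  fixes x :: "'a::unital_cstar_algebra"
  assumes "norm x < 1"
  shows "\<exists>b. (1 - x) * b = 1 \<and> b * (1 - x) = 1"
proof -
  have s: "summable (\<lambda>n. x ^ n)"
    using assms by (rule complete_algebra_summable_geometric)
  have shift: "(\<Sum>n. x ^ Suc n) = (\<Sum>n. x ^ n) - 1"
    using suminf_split_head[OF s] by simp
  have "x * (\<Sum>n. x ^ n) = (\<Sum>n. x ^ n) - 1"
    using suminf_mult[OF s, of x] shift by simp
  moreover have "(\<Sum>n. x ^ n) * x = (\<Sum>n. x ^ n) - 1"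
    using suminf_mult2[OF s, of x] shift by (simp add: power_commutes)
  ultimately show ?thesis
    by (intro exI[of _ "\<Sum>n. x ^ n"]) (simp add: algebra_simps)
qed

lemma spectrum_norm_bound:
  fixes a :: "'a::unital_cstar_algebra"
  assumes "z \<in> spectrum a"
  shows "cmod z \<le> norm a"
proof (rule ccontr)
  assume "\<not> ?thesis"
  then have "norm a < cmod z"
    by simp
  then have z: "z \<noteq> 0"
    using norm_ge_zero[of a] by fastforce
  have "norm (inverse z *\<^sub>C a) < 1"
  proof -
    have "norm (inverse z *\<^sub>C a) = norm a / cmod z"
      by (simp add: norm_scaleC norm_inverse divide_inverse)
    then show ?thesis
      using \<open>norm a < cmod z\<close> z by simp
  qed
  then obtain b where b: "(1 - inverse z *\<^sub>C a) * b = 1" "b * (1 - inverse z *\<^sub>C a) = 1"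
    using neumann_inverse by blast
  have "z *\<^sub>C (1 - inverse z *\<^sub>C a) = z *\<^sub>C 1 - a"
  proof -
    have "z *\<^sub>C (1 - inverse z *\<^sub>C a) + z *\<^sub>C (inverse z *\<^sub>C a) = z *\<^sub>C 1"
      by (simp flip: scaleC_add_right)
    then show ?thesis
      using z by (simp add: scaleC_scaleC scaleC_one algebra_simps)
  qed
  then have "z *\<^sub>C 1 - a = z *\<^sub>C (1 - inverse z *\<^sub>C a)"
    by simp
  then have "(z *\<^sub>C 1 - a) * (inverse z *\<^sub>C b) = 1 \<and> (inverse z *\<^sub>C b) * (z *\<^sub>C 1 - a) = 1"
    using b z by (simp add: mult_scaleC_left mult_scaleC_right scaleC_scaleC scaleC_one)
  then show False
    using assms unfolding spectrum_def by blast
qed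

lemma spectrum_translate:
  "z \<in> spectrum a \<Longrightarrow> z + w \<in> spectrum (a + w *\<^sub>C (1::'a::unital_cstar_algebra))"
  by (simp add: spectrum_def scaleC_add_left)

lemma spectrum_uminus:
  assumes "z \<in> spectrum (a::'a::unital_cstar_algebra)"
  shows "- z \<in> spectrum (- a)"
proof (rule ccontr)
  assume "\<not> ?thesis"
  then obtain b where "((- z) *\<^sub>C 1 - (- a)) * b = 1" "b * ((- z) *\<^sub>C 1 - (- a)) = 1"
    by (auto simp: spectrum_def)
  then have "(z *\<^sub>C 1 - a) * (- b) = 1 \<and> (- b) * (z *\<^sub>C 1 - a) = 1"
    by (simp add: scaleC_minus_left algebra_simps)
  then show False
    using assms unfolding spectrum_def by blast
qed

lemma spectrum_reflect:
  assumes "z \<in> spectrum (t *\<^sub>R 1 - (a::'a::unital_cstar_algebra))"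
  shows "complex_of_real t - z \<in> spectrum a"
  using spectrum_translate[OF spectrum_uminus[OF assms], of "complex_of_real t"]
  by (simp add: scaleC_of_real)

text \<open>Translating by \<open>\<i> * t\<close> increases the squared modulus of a spectral value \<open>z\<close> by
  \<open>2 * t * Im z\<close> plus \<open>t\<^sup>2\<close>, whereas by the \<open>C\<^sup>*\<close>-identity the squared norm of the
  element grows by at most \<open>t\<^sup>2\<close>. Letting \<open>t\<close> vary over the reals excludes a non-zero
  imaginary part.\<close>

lemma spectrum_self_adjoint_real:
  fixes a :: "'a::unital_cstar_algebra"
  assumes sa: "self_adjoint a" and z: "z \<in> spectrum a"
  shows "Im z = 0"
proof (rule ccontr)
  assume im: "Im z \<noteq> 0"
  have bound: "2 * Im z * t \<le> (norm a)\<^sup>2" for t :: real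
  proof -
    define w where "w = Complex 0 t"
    define c where "c = a + w *\<^sub>C 1"
    have ww: "w * w = complex_of_real (- t\<^sup>2)"
      by (simp add: w_def complex_eq_iff power2_eq_square)
    have "cnj w = - w"
      by (simp add: w_def complex_eq_iff)
    then have adjc: "adj c = a - w *\<^sub>C 1"
      using sa by (simp add: c_def adj_add adj_scaleC adj_one self_adjoint_def scaleC_minus_left)
    have "adj c * c = a * a - (w * w) *\<^sub>C 1"
      unfolding adjc unfolding c_def
      by (simp add: algebra_simps scaleC_diff_right mult_scaleC_left mult_scaleC_right scaleC_scaleC)
    then have "adj c * c = a * a + t\<^sup>2 *\<^sub>R 1"
      unfolding ww scaleC_of_real by simp
    then have "(norm c)\<^sup>2 = norm (a * a + t\<^sup>2 *\<^sub>R 1)"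
      by (simp flip: cstar_identity)
    also have "\<dots> \<le> (norm a)\<^sup>2 + t\<^sup>2"
      by (rule norm_triangle_le) (simp add: norm_square_self_adjoint[OF sa])
    finally have "(norm c)\<^sup>2 \<le> (norm a)\<^sup>2 + t\<^sup>2" .
    moreover have "(cmod (z + w))\<^sup>2 \<le> (norm c)\<^sup>2"
      using spectrum_norm_bound[OF spectrum_translate[OF z, of w]] by (simp add: c_def power_mono)
    moreover have "(cmod (z + w))\<^sup>2 = (Re z)\<^sup>2 + (Im z)\<^sup>2 + 2 * Im z * t + t\<^sup>2"
      by (simp add: cmod_power2 w_def power2_sum)
    ultimately show ?thesis
      using zero_le_power2[of "Re z"] zero_le_power2[of "Im z"] by linarith
  qed
  have "2 * Im z * (((norm a)\<^sup>2 + 1) / (2 * Im z)) = (norm a)\<^sup>2 + 1"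
    using im by simp
  then show False
    using bound[of "((norm a)\<^sup>2 + 1) / (2 * Im z)"] by linarith
qed

section \<open>The norm of a self-adjoint element is its spectral radius\<close>

text \<open>Writing the root as \<open>1 - x\<close> turns the equation into \<open>x = (w + x * x) / 2\<close>, a
  contraction on the ball of radius \<open>norm w\<close>. The ball is cut down to the self-adjoint elements
  of the bicommutant of \<open>w\<close>, a closed set which the contraction preserves, so that roots of
  commuting elements commute.\<close>

lemma sqrt_one_minus:
  fixes w :: "'a::unital_cstar_algebra"
  assumes sa: "self_adjoint w" and w: "norm w < 1"
  obtains y where "self_adjoint y" "y * y = 1 - w" "\<And>v. v * w = w * v \<Longrightarrow> v * y = y * v"
proof -
  define S where "S = cball 0 (norm w) \<inter> {x. adj x = x} \<inter> (\<Inter>v\<in>{v. v * w = w * v}. {x. v * x = x * v})"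
  define f where "f x = (1/2) *\<^sub>R (w + x * x)" for x
  have cadj: "continuous_on UNIV (adj :: 'a \<Rightarrow> 'a)"
    by (rule linear_continuous_on[OF bounded_linear_adj])
  have "closed S"
    unfolding S_def
    by (intro closed_Int closed_cball closed_INT ballI closed_Collect_eq continuous_intros cadj)
  then have complete_S: "complete S"
    by (simp add: complete_eq_closed)
  have "0 \<in> S"
    by (simp add: S_def adj_zero)
  then have ne: "S \<noteq> {}"
    by blast
  have maps: "f ` S \<subseteq> S"
  proof (rule image_subsetI)
    fix x assume "x \<in> S"
    then have x: "norm x \<le> norm w" "adj x = x" "\<And>v. v * w = w * v \<Longrightarrow> v * x = x * v"
      unfolding S_def by auto
    have "norm (w + x * x) \<le> norm w + norm x * norm x"
      by (intro norm_triangle_le add_left_mono norm_mult_ineq)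
    also have "\<dots> \<le> norm w + norm w * 1"
      using x(1) w by (intro add_left_mono mult_mono) auto
    finally have "norm (f x) \<le> norm w"
      by (simp add: f_def)
    moreover have "adj (f x) = f x"
      using x(2) sa by (simp add: f_def adj_scaleR adj_add adj_mult self_adjoint_def)
    moreover have "v * f x = f x * v" if "v * w = w * v" for v
    proof -
      have "v * x = x * v"
        using x(3) that by blast
      then have "v * (x * x) = (x * x) * v"
        by (metis mult.assoc)
      then show ?thesis
        using that by (simp add: f_def algebra_simps)
    qed
    ultimately show "f x \<in> S"
      unfolding S_def by auto
  qed
  have lip: "dist (f x) (f y) \<le> norm w * dist x y" if "x \<in> S" "y \<in> S" for x y
  proof -
    have "f x - f y = (1/2) *\<^sub>R (x * (x - y) + (x - y) * y)"
      by (simp add: f_def algebra_simps)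
    then have "norm (f x - f y) \<le> (norm (x * (x - y)) + norm ((x - y) * y)) / 2"
      using norm_triangle_ineq[of "x * (x - y)" "(x - y) * y"] by simp
    also have "\<dots> \<le> (norm w * norm (x - y) + norm (x - y) * norm w) / 2"
      using that by (intro divide_right_mono add_mono order_trans[OF norm_mult_ineq] mult_mono)
        (auto simp: S_def)
    finally show ?thesis
      by (simp add: dist_norm mult.commute)
  qed
  obtain x where x: "x \<in> S" "f x = x"
    using Banach_fix[OF complete_S ne norm_ge_zero w maps lip] by blast
  have xS: "adj x = x" "\<And>v. v * w = w * v \<Longrightarrow> v * x = x * v"
    using x(1) unfolding S_def by auto
  have eq: "w + x * x = 2 *\<^sub>R x"
    using x(2) unfolding f_def by (metis scaleR_half_double scaleR_right_distrib scaleR_2)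
  show thesis
  proof
    show "self_adjoint (1 - x)"
      using xS(1) by (simp add: self_adjoint_def adj_diff adj_one)
    show "(1 - x) * (1 - x) = 1 - w"
      using eq by (simp add: algebra_simps scaleR_2)
    show "v * (1 - x) = (1 - x) * v" if "v * w = w * v" for v
      using xS(2)[OF that] by (simp add: algebra_simps)
  qed
qed

text \<open>If \<open>1 - b * b\<close> is invertible, then \<open>1 - s\<^sup>2 *\<^sub>R (b * b)\<close> still has a square root \<open>y\<close> for some
  \<open>s > 1\<close>, and \<open>s *\<^sub>R b\<close> is the real part of the unitary \<open>s *\<^sub>R b + \<i> *\<^sub>C y\<close>, hence a
  contraction.\<close>

lemma norm_less_one_if_invertible:
  fixes b :: "'a::unital_cstar_algebra"
  assumes sa: "self_adjoint b" and b: "norm b \<le> 1"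
    and e: "(1 - b * b) * e = 1" "e * (1 - b * b) = 1"
  shows "norm b < 1"
proof -
  define c where "c = b * b"
  have sac: "self_adjoint c"
    unfolding c_def using sa by (intro self_adjoint_mult) auto
  have nc: "norm c \<le> 1"
    using b by (simp add: c_def norm_square_self_adjoint[OF sa] power_le_one)
  have e0: "e \<noteq> 0"
    using e by auto
  \<comment> \<open>The root of \<open>1 - c\<close> is not within reach of the contraction when \<open>c\<close> has norm one,
     so the step starts from the slightly shrunk \<open>1 - (1 - \<delta>) *\<^sub>R c\<close>, whose inverse stays
     bounded as \<open>\<delta>\<close> vanishes.\<close>
  define \<delta> where "\<delta> = min (1/2) (1 / (4 * norm e))"
  have \<delta>: "0 < \<delta>" "\<delta> < 1" "\<delta> * norm e \<le> 1/4"
    using e0 by (auto simp: \<delta>_def min_def field_simps)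
  have "norm ((1 - \<delta>) *\<^sub>R c) \<le> (1 - \<delta>) * 1"
    using \<delta> nc by (auto intro!: mult_left_mono)
  then have n1: "norm ((1 - \<delta>) *\<^sub>R c) < 1"
    by (rule le_less_trans) (use \<delta> in simp)
  then obtain g where g: "(1 - (1 - \<delta>) *\<^sub>R c) * g = 1" "g * (1 - (1 - \<delta>) *\<^sub>R c) = 1"
    using neumann_inverse by blast
  have gsa: "self_adjoint g"
    by (rule inverse_self_adjoint[OF _ g]) (simp add: sac)
  have gcomm: "v * g = g * v" if "v * c = c * v" for v
    by (rule inverse_commutes[OF g]) (simp add: that algebra_simps)
  have "norm g \<le> norm e + 1/4 * norm g"
  proof -
    have "1 - c = (1 - (1 - \<delta>) *\<^sub>R c) - \<delta> *\<^sub>R c"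
      by (simp add: algebra_simps)
    then have "(1 - c) * g = 1 - \<delta> *\<^sub>R (c * g)"
      using g(1) by (metis left_diff_distrib mult_scaleR_left)
    moreover have "e * ((1 - c) * g) = g"
      using e(2) by (simp add: c_def flip: mult.assoc)
    ultimately have "g = e - \<delta> *\<^sub>R (e * (c * g))"
      by (simp add: right_diff_distrib)
    then have "norm g \<le> norm e + norm (\<delta> *\<^sub>R (e * (c * g)))"
      by (metis norm_triangle_ineq4)
    also have "norm (\<delta> *\<^sub>R (e * (c * g))) \<le> \<delta> * (norm e * (1 * norm g))"
      using \<delta> nc by (auto intro!: mult_left_mono order_trans[OF norm_mult_ineq] mult_left_le_one_le)
    also have "\<dots> \<le> 1/4 * norm g"
      using mult_right_mono[OF \<delta>(3), of "norm g"] by (simp add: mult.assoc)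
    finally show ?thesis
      by simp
  qed
  then have "norm g \<le> 4/3 * norm e"
    by simp
  \<comment> \<open>Chosen so that \<open>(1 - (1 - \<delta>) *\<^sub>R c) * (1 - w) = 1 - (1 + \<delta>) *\<^sub>R c\<close>; both factors on the
     left have square roots.\<close>
  define w where "w = (2 * \<delta>) *\<^sub>R (c * g)"
  have "norm (c * g) \<le> 1 * (4/3 * norm e)"
    using nc \<open>norm g \<le> 4/3 * norm e\<close>
    by (intro order_trans[OF norm_mult_ineq] mult_mono) auto
  then have "2 * \<delta> * norm (c * g) \<le> 2 * \<delta> * (4/3 * norm e)"
    using \<delta>(1) by (intro mult_left_mono) auto
  moreover have "norm w = 2 * \<delta> * norm (c * g)"
    using \<delta>(1) by (simp add: w_def)
  ultimately have nw: "norm w < 1"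
    using \<delta>(3) by simp
  have wsa: "self_adjoint w"
    unfolding w_def by (intro self_adjoint_simps self_adjoint_mult sac gsa gcomm refl)
  have wcomm: "v * w = w * v" if "v * c = c * v" for v
  proof -
    have "v * (c * g) = (c * g) * v"
      using that gcomm[OF that] by (metis mult.assoc)
    then show ?thesis
      by (simp add: w_def)
  qed
  obtain y1 where y1: "self_adjoint y1" "y1 * y1 = 1 - (1 - \<delta>) *\<^sub>R c"
    and y1comm: "\<And>v. v * ((1 - \<delta>) *\<^sub>R c) = ((1 - \<delta>) *\<^sub>R c) * v \<Longrightarrow> v * y1 = y1 * v"
    using sqrt_one_minus[of "(1 - \<delta>) *\<^sub>R c"] n1 sac by (metis self_adjoint_simps(6))
  obtain y2 where y2: "self_adjoint y2" "y2 * y2 = 1 - w"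
    and y2comm: "\<And>v. v * w = w * v \<Longrightarrow> v * y2 = y2 * v"
    using sqrt_one_minus[OF wsa nw] by metis
  have y1c: "v * y1 = y1 * v" if "v * c = c * v" for v
    by (rule y1comm) (simp add: that)
  have y2c: "v * y2 = y2 * v" if "v * c = c * v" for v
    by (rule y2comm) (rule wcomm[OF that])
  have "y1 * c = c * y1"
    using y1c[of c] by simp
  then have y12: "y1 * y2 = y2 * y1"
    by (rule y2c)
  have bc: "b * c = c * b"
    by (simp add: c_def mult.assoc)
  define y where "y = y1 * y2"
  define s where "s = sqrt (1 + \<delta>)"
  have ysa: "adj y = y"
    using self_adjoint_mult[OF y1(1) y2(1) y12] by (simp add: y_def self_adjoint_def)
  have by_comm: "b * y = y * b"
    unfolding y_def using y1c[OF bc] y2c[OF bc] by (metis mult.assoc)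
  have "y * y = (y1 * y1) * (y2 * y2)"
    unfolding y_def using y12 by (metis mult.assoc)
  also have "\<dots> = (1 - (1 - \<delta>) *\<^sub>R c) - (2 * \<delta>) *\<^sub>R ((1 - (1 - \<delta>) *\<^sub>R c) * g * c)"
    unfolding y1 y2 w_def using gcomm[of c] by (simp add: right_diff_distrib mult.assoc)
  also have "\<dots> = 1 - (1 + \<delta>) *\<^sub>R c"
    unfolding g mult_2 scaleR_left_distrib by (simp add: scaleR_left_diff_distrib)
  finally have yy: "y * y = 1 - (1 + \<delta>) *\<^sub>R c" .
  have ss: "s * s = 1 + \<delta>" "1 < s"
    using \<delta> by (simp_all add: s_def)
  define u where "u = s *\<^sub>R b + \<i> *\<^sub>C y"
  have adju: "adj u = s *\<^sub>R b - \<i> *\<^sub>C y"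
    using sa ysa by (simp add: u_def adj_add adj_scaleR adj_scaleC self_adjoint_def scaleC_minus_left)
  have iiy: "\<i> *\<^sub>C (\<i> *\<^sub>C x) = - x" for x :: 'a
    by (simp add: scaleC_scaleC scaleC_minus_left scaleC_one)
  have "adj u * u = (s * s) *\<^sub>R (b * b) + s *\<^sub>R (\<i> *\<^sub>C (b * y)) - s *\<^sub>R (\<i> *\<^sub>C (y * b)) + y * y"
    unfolding adju unfolding u_def
    by (simp add: algebra_simps scaleC_diff_right mult_scaleC_left mult_scaleC_right scaleC_scaleR iiy)
  also have "\<dots> = 1"
    using by_comm yy ss by (simp add: c_def)
  finally have "norm u \<le> 1"
    by (rule norm_isometry_le_one)
  moreover have "u + adj u = (2 * s) *\<^sub>R b"
    unfolding adju by (simp add: u_def scaleR_2 flip: scaleR_scaleR)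
  then have "2 * s * norm b \<le> norm u + norm (adj u)"
    using norm_triangle_ineq[of u "adj u"] ss by simp
  ultimately have "s * norm b \<le> 1"
    by (simp add: norm_adj)
  then show ?thesis
    using ss by (cases "norm b = 0") (auto simp: intro: less_le_trans[of _ "s * norm b"])
qed

text \<open>If \<open>\<tau> = norm a\<close> exceeded \<open>t\<close>, neither \<open>\<tau>\<close> nor \<open>- \<tau>\<close> would be spectral, and
  \<open>\<tau>\<^sup>2 *\<^sub>R 1 - a * a\<close>, the product of the two corresponding factors up to sign, would be
  invertible.\<close>

lemma norm_le_spectral_bound:
  fixes a :: "'a::unital_cstar_algebra"
  assumes sa: "self_adjoint a" and spec: "spectrum a \<subseteq> complex_of_real ` {- t..t}" and "0 \<le> t"
  shows "norm a \<le> t"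
proof (rule ccontr)
  assume not_le: "\<not> norm a \<le> t"
  define \<tau> where "\<tau> = norm a"
  have \<tau>: "t < \<tau>" "0 < \<tau>"
    using not_le \<open>0 \<le> t\<close> by (auto simp: \<tau>_def)
  have "complex_of_real \<tau> \<notin> spectrum a" "complex_of_real (- \<tau>) \<notin> spectrum a"
    using spec \<tau> by (auto simp: image_iff simp flip: of_real_minus)
  then have "\<exists>f. (\<tau> *\<^sub>R 1 - a) * f = 1 \<and> f * (\<tau> *\<^sub>R 1 - a) = 1"
    and "\<exists>h. ((- \<tau>) *\<^sub>R 1 - a) * h = 1 \<and> h * ((- \<tau>) *\<^sub>R 1 - a) = 1"
    by (simp_all only: spectrum_def scaleC_of_real mem_Collect_eq not_not)
  then obtain f h where f: "(\<tau> *\<^sub>R 1 - a) * f = 1" "f * (\<tau> *\<^sub>R 1 - a) = 1"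
    and h: "((- \<tau>) *\<^sub>R 1 - a) * h = 1" "h * ((- \<tau>) *\<^sub>R 1 - a) = 1"
    by blast
  define b where "b = (1 / \<tau>) *\<^sub>R a"
  have b: "self_adjoint b" "norm b = 1"
    using sa \<tau> by (auto simp: b_def \<tau>_def)
  define m where "m = \<tau> *\<^sub>R 1 - a"
  define n where "n = (- \<tau>) *\<^sub>R 1 - a"
  have mn: "m * n = n * m"
    by (simp add: m_def n_def algebra_simps)
  have fac: "1 - b * b = (- (1 / \<tau>\<^sup>2)) *\<^sub>R (m * n)"
    using \<tau> by (simp add: m_def n_def b_def algebra_simps power2_eq_square)
  define e where "e = (- (\<tau>\<^sup>2)) *\<^sub>R (h * f)"
  have "m * n * (h * f) = m * (n * h) * f" "h * f * (m * n) = h * (f * m) * n"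
    by (simp_all only: mult.assoc)
  then have "m * n * (h * f) = 1" "h * f * (m * n) = 1"
    using f h by (simp_all add: m_def n_def)
  then have "(1 - b * b) * e = 1" "e * (1 - b * b) = 1"
    unfolding fac e_def using \<tau> by simp_all
  then show False
    using norm_less_one_if_invertible[OF b(1)] b(2) by auto
qed

section \<open>The cone of positive elements\<close>

text \<open>The spectrum of \<open>a\<close> is real, and the norm bound confines it to the disc of radius \<open>t\<close>
  about \<open>t\<close>, which meets the real line in non-negative numbers only.\<close>

lemma positive_if_norm_le:
  fixes a :: "'a::unital_cstar_algebra"
  assumes sa: "self_adjoint a" and t: "norm (t *\<^sub>R 1 - a) \<le> t"
  shows "a \<in> positive_elements"
proof -
  have "z \<in> complex_of_real ` {0..}" if z: "z \<in> spectrum a" for z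
  proof -
    have real: "z = complex_of_real (Re z)"
      using spectrum_self_adjoint_real[OF sa z] by (simp add: complex_eq_iff)
    have "complex_of_real t - z \<in> spectrum (t *\<^sub>R 1 - a)"
      using spectrum_reflect[of z t "t *\<^sub>R 1 - a"] z by simp
    then have "cmod (complex_of_real t - z) \<le> t"
      using spectrum_norm_bound t by (metis order_trans)
    then have "\<bar>t - Re z\<bar> \<le> t"
      using real by (metis norm_of_real of_real_diff)
    then show ?thesis
      using real by auto
  qed
  then show ?thesis
    using sa by (auto simp: positive_elements_def)
qed

lemma norm_bound_minus_positive:
  fixes a :: "'a::unital_cstar_algebra"
  assumes "self_adjoint a" "norm a \<le> t"
  shows "t *\<^sub>R 1 - a \<in> positive_elements"
  using assms by (intro positive_if_norm_le[where t = t]) auto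

lemma norm_le_if_positive:
  fixes a :: "'a::unital_cstar_algebra"
  assumes "a \<in> positive_elements" "t *\<^sub>R 1 - a \<in> positive_elements" "0 \<le> t"
  shows "norm a \<le> t"
proof (rule norm_le_spectral_bound)
  show "spectrum a \<subseteq> complex_of_real ` {- t..t}"
  proof
    fix z assume z: "z \<in> spectrum a"
    then obtain r where r: "z = complex_of_real r" "0 \<le> r"
      using assms(1) by (auto simp: positive_elements_def)
    have "complex_of_real t - z \<in> spectrum (t *\<^sub>R 1 - a)"
      using spectrum_reflect[of z t "t *\<^sub>R 1 - a"] z by simp
    then have "complex_of_real (t - r) \<in> complex_of_real ` {0..}"
      using assms(2) r by (auto simp: positive_elements_def)
    then have "r \<le> t"
      by (auto simp del: of_real_diff)
    then show "z \<in> complex_of_real ` {- t..t}"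
      using r by auto
  qed
qed (use assms in \<open>auto simp: positive_elements_def\<close>)

lemma positive_norm_diff_le:
  fixes a :: "'a::unital_cstar_algebra"
  assumes "a \<in> positive_elements"
  shows "norm (norm a *\<^sub>R 1 - a) \<le> norm a"
proof (rule norm_le_if_positive)
  show "norm a *\<^sub>R 1 - a \<in> positive_elements"
    using assms by (intro norm_bound_minus_positive) (auto simp: positive_elements_def)
qed (use assms in auto)

text \<open>The spectrum of a sum is not controlled by the spectra of the summands when these do not
  commute; the triangle inequality for the norm takes over.\<close>

lemma positive_add:
  fixes a b :: "'a::unital_cstar_algebra"
  assumes "a \<in> positive_elements" "b \<in> positive_elements"
  shows "a + b \<in> positive_elements"
proof (rule positive_if_norm_le)
  show "self_adjoint (a + b)"
    using assms by (simp add: positive_elements_def)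
  have "(norm a + norm b) *\<^sub>R 1 - (a + b) = (norm a *\<^sub>R 1 - a) + (norm b *\<^sub>R 1 - b)"
    by (simp add: algebra_simps)
  then show "norm ((norm a + norm b) *\<^sub>R 1 - (a + b)) \<le> norm a + norm b"
    using norm_triangle_mono[OF positive_norm_diff_le positive_norm_diff_le] assms by metis
qed

text \<open>As \<open>b\<close> lies below \<open>norm b *\<^sub>R 1\<close>, so does \<open>a\<close>; this bounds the spectrum of \<open>a\<close>, hence its
  norm.\<close>

lemma norm_mono:
  fixes a b :: "'a::unital_cstar_algebra"
  assumes "0 \<preceq> a" "a \<preceq> b"
  shows "norm a \<le> norm b"
proof (rule norm_le_if_positive)
  show "a \<in> positive_elements"
    using assms by (simp add: cstar_le_def)
  have "norm b *\<^sub>R 1 - b \<in> positive_elements"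
    using assms by (intro norm_bound_minus_positive) (auto simp: cstar_le_def)
  then have "(norm b *\<^sub>R 1 - b) + (b - a) \<in> positive_elements"
    using assms by (intro positive_add) (auto simp: cstar_le_def)
  then show "norm b *\<^sub>R 1 - a \<in> positive_elements"
    by simp
qed simp

lemma square_le_if_norm_le:
  fixes q :: "'a::unital_cstar_algebra"
  assumes sa: "self_adjoint q" and q: "norm q \<le> \<epsilon>"
  shows "q * adj q \<preceq> \<epsilon>\<^sup>2 *\<^sub>R 1"
proof -
  have qq: "self_adjoint (q * q)"
    by (intro self_adjoint_mult sa refl)
  moreover have "norm (q * q) \<le> \<epsilon>\<^sup>2"
    using q by (simp add: norm_square_self_adjoint[OF sa] power_mono)
  ultimately have "\<epsilon>\<^sup>2 *\<^sub>R 1 - q * q \<in> positive_elements"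
    by (rule norm_bound_minus_positive)
  then show ?thesis
    using sa qq by (simp add: cstar_le_def self_adjoint_def adj_scaleR adj_one)
qed

section \<open>The norm of a partial metric\<close>

context cstar_partial_metric_space
begin

lemma self_adjoint_p: "x \<in> X \<Longrightarrow> y \<in> X \<Longrightarrow> self_adjoint (p x y)"
  using nonneg by (simp add: cstar_le_def)

lemma norm_self_le: "x \<in> X \<Longrightarrow> y \<in> X \<Longrightarrow> norm (p x x) \<le> norm (p x y)"
  by (intro norm_mono nonneg self_le)

lemma norm_triangle_p:
  assumes "x \<in> X" "y \<in> X" "z \<in> X"
  shows "norm (p x y) \<le> norm (p x z) + norm (p z y)"
proof -
  have "p x z + p z y - p z z - p x y \<in> positive_elements" "p z z \<in> positive_elements"
    using triangle[OF assms] nonneg[of z z] assms by (auto simp: cstar_le_def)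
  from positive_add[OF this] have "p x y \<preceq> p x z + p z y"
    using assms by (simp add: cstar_le_def self_adjoint_p)
  then have "norm (p x y) \<le> norm (p x z + p z y)"
    using assms by (intro norm_mono nonneg)
  then show ?thesis
    using norm_triangle_ineq order_trans by blast
qed

lemma eq_if_norm_zero:
  assumes "x \<in> X" "y \<in> X" "norm (p x y) \<le> 0"
  shows "x = y"
  using assms norm_self_le[of x y] norm_self_le[of y x] symmetric[of x y] eq_iff[of x y] by auto

text \<open>The centring terms are self-distances, which the hypothesis also makes small, as it covers
  \<open>n = m\<close>.\<close>

lemma partial_CauchyI:
  assumes s: "range s \<subseteq> X"
    and small: "\<And>\<epsilon>. 0 < \<epsilon> \<Longrightarrow> \<exists>N. \<forall>n>N. \<forall>m>N. norm (p (s n) (s m)) \<le> \<epsilon>"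
  shows "partial_Cauchy p s"
  unfolding partial_Cauchy_def
proof (intro allI impI)
  fix \<epsilon> :: real assume "0 < \<epsilon>"
  then obtain N where N: "\<And>n m. n > N \<Longrightarrow> m > N \<Longrightarrow> norm (p (s n) (s m)) \<le> \<epsilon> / 2"
    using small[of "\<epsilon> / 2"] by auto
  have "centred p (s n) (s m) * adj (centred p (s n) (s m)) \<preceq> \<epsilon>\<^sup>2 *\<^sub>R 1" if "n > N" "m > N" for n m
  proof (rule square_le_if_norm_le)
    have X: "s n \<in> X" "s m \<in> X"
      using s by auto
    show "self_adjoint (centred p (s n) (s m))"
      unfolding centred_def using X by (simp add: self_adjoint_p)
    have "norm (centred p (s n) (s m))
        \<le> norm (p (s n) (s m)) + norm (p (s n) (s n)) / 2 + norm (p (s m) (s m)) / 2"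
      unfolding centred_def
      using norm_triangle_ineq4[of "p (s n) (s m) - (1/2) *\<^sub>R p (s n) (s n)" "(1/2) *\<^sub>R p (s m) (s m)"]
        norm_triangle_ineq4[of "p (s n) (s m)" "(1/2) *\<^sub>R p (s n) (s n)"] by simp
    also have "\<dots> \<le> \<epsilon>"
      using N[of n m] N[of n n] N[of m m] that by simp
    finally show "norm (centred p (s n) (s m)) \<le> \<epsilon>" .
  qed
  then show "\<exists>N. \<forall>n>N. \<forall>m>N. centred p (s n) (s m) * adj (centred p (s n) (s m)) \<preceq> \<epsilon>\<^sup>2 *\<^sub>R 1"
    by blast
qed

end

section \<open>The fixed point\<close>

text \<open>With \<open>D = norm (p x (T x))\<close>, the number \<open>D / (1 - k)\<close> is the fixed point of
  \<open>r \<mapsto> D + k * r\<close>, so it bounds the distance from \<open>x\<close> to every point of its orbit by induction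
  along the orbit: go from \<open>x\<close> to \<open>T x\<close>, then apply the contraction. Shifting both arguments by
  \<open>n\<close> gains the factor \<open>k ^ n\<close>. The case \<open>j = 0\<close> concerns the self-distances, which need not
  vanish in a partial metric space.\<close>

lemma (in cstar_partial_metric_space) orbit_norm_bound:
  assumes T: "T \<in> X \<rightarrow> X" and k: "0 < k" "k < 1"
    and contr: "\<And>x y. x \<in> X \<Longrightarrow> y \<in> X \<Longrightarrow> norm (p (T x) (T y)) \<le> k * norm (p x y)"
    and x: "x \<in> X"
  shows "norm (p ((T ^^ n) x) ((T ^^ (n + j)) x)) \<le> k ^ n * (norm (p x (T x)) / (1 - k))"
proof (induction n)
  case 0
  define D where "D = norm (p x (T x))"
  have X: "(T ^^ i) x \<in> X" for i
    using T x by (induction i) auto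
  have D: "D + k * (D / (1 - k)) = D / (1 - k)"
    using k by (simp add: field_simps)
  have "norm (p x ((T ^^ j) x)) \<le> D / (1 - k)"
  proof (induction j)
    case 0
    have "norm (p x x) \<le> D"
      unfolding D_def using T x by (intro norm_self_le) auto
    also have "D \<le> D / (1 - k)"
      using k by (simp add: D_def field_simps mult_left_le)
    finally show ?case
      by simp
  next
    case (Suc j)
    have "norm (p x ((T ^^ Suc j) x)) \<le> D + norm (p (T x) (T ((T ^^ j) x)))"
      unfolding D_def using T x X[of j] by (simp add: norm_triangle_p Pi_iff)
    also have "\<dots> \<le> D + k * (D / (1 - k))"
      using contr[OF x X[of j]] Suc mult_left_mono[OF Suc, of k] k by linarith
    finally show ?case
      unfolding D .
  qed
  then show ?case
    by (simp add: D_def)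
next
  case (Suc n)
  have X: "(T ^^ i) x \<in> X" for i
    using T x by (induction i) auto
  have "norm (p ((T ^^ Suc n) x) ((T ^^ (Suc n + j)) x))
      \<le> k * norm (p ((T ^^ n) x) ((T ^^ (n + j)) x))"
    using contr[OF X[of n] X[of "n + j"]] by simp
  also have "\<dots> \<le> k * (k ^ n * (norm (p x (T x)) / (1 - k)))"
    using Suc k by (intro mult_left_mono) auto
  finally show ?case
    by (simp only: power_Suc mult.assoc)
qed

theorem corollary4p1:
  fixes X :: "'x set"
    and p :: "'x \<Rightarrow> 'x \<Rightarrow> 'a::unital_cstar_algebra"
    and T :: "'x \<Rightarrow> 'x"
    and k :: real
  assumes "complete_cstar_partial_metric_space X p"
    and "T \<in> X \<rightarrow> X"
    and "0 < k" and "k < 1"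
    and "\<And>x y. \<lbrakk>x \<in> X; y \<in> X\<rbrakk> \<Longrightarrow> p (T x) (T y) \<preceq> k *\<^sub>R p x y"
  shows "\<exists>u\<in>X. T u = u \<and> (\<forall>v\<in>X. T v = v \<longrightarrow> v = u) \<and> p u u = 0"
proof -
  interpret complete_cstar_partial_metric_space X p
    by fact
  have TX: "T x \<in> X" if "x \<in> X" for x
    using assms(2) that by auto
  have contr: "norm (p (T x) (T y)) \<le> k * norm (p x y)" if "x \<in> X" "y \<in> X" for x y
    using norm_mono[OF nonneg assms(5)] TX that \<open>0 < k\<close> by simp
  obtain x where x: "x \<in> X"
    using nonempty by blast
  define s where "s n = (T ^^ n) x" for n
  have sX: "s n \<in> X" for n
    unfolding s_def using TX x by (induction n) auto
  define C where "C = norm (p x (T x)) / (1 - k)"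
  have bound: "norm (p (s n) (s (n + j))) \<le> k ^ n * C" for n j
    unfolding s_def C_def
    by (rule orbit_norm_bound[OF assms(2) \<open>0 < k\<close> \<open>k < 1\<close> contr x])
  have vanish: "(\<lambda>n. k ^ n * C) \<longlonglongrightarrow> 0"
    using assms(3,4) by (intro tendsto_mult_left_zero LIMSEQ_power_zero) auto
  have "partial_Cauchy p s"
  proof (rule partial_CauchyI)
    fix \<epsilon> :: real assume "0 < \<epsilon>"
    then obtain N where N: "\<And>n. n \<ge> N \<Longrightarrow> k ^ n * C < \<epsilon>"
      using order_tendstoD(2)[OF vanish, of \<epsilon>] by (auto simp: eventually_sequentially)
    have le: "norm (p (s n) (s m)) \<le> \<epsilon>" if "n > N" "n \<le> m" for n m
      using bound[of n "m - n"] N[of n] that by simp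
    have "norm (p (s n) (s m)) \<le> \<epsilon>" if "n > N" "m > N" for n m
      using le[of n m] le[of m n] that symmetric[OF sX sX, of n m] by (cases "n \<le> m") auto
    then show "\<exists>N. \<forall>n>N. \<forall>m>N. norm (p (s n) (s m)) \<le> \<epsilon>"
      by blast
  qed (use sX in auto)
  then obtain u where u: "u \<in> X"
    and conv: "(\<lambda>n. p (s n) u - p u u) \<longlonglongrightarrow> 0" and cent: "(\<lambda>n. centred p (s n) u) \<longlonglongrightarrow> 0"
    using complete[of s] sX by (auto simp: converges_to_def)
  have self0: "(\<lambda>n. p (s n) (s n)) \<longlonglongrightarrow> 0"
    by (rule Lim_null_comparison[OF _ vanish]) (use bound[of _ 0] in auto)
  \<comment> \<open>The two limits of the completeness axiom subtract \<open>p u u\<close> once and only half of it,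
     so together they force it to vanish.\<close>
  have "(\<lambda>n. (p (s n) u - p u u) - centred p (s n) u - (1/2) *\<^sub>R p (s n) (s n))
      \<longlonglongrightarrow> 0 - 0 - (1/2) *\<^sub>R 0"
    by (intro tendsto_diff tendsto_scaleR tendsto_const conv cent self0)
  moreover have "(p (s n) u - p u u) - centred p (s n) u - (1/2) *\<^sub>R p (s n) (s n)
      = - ((1/2) *\<^sub>R p u u)" for n
  proof -
    have "p u u = (1/2) *\<^sub>R p u u + (1/2) *\<^sub>R p u u"
      by (simp flip: scaleR_add_left)
    then show ?thesis
      unfolding centred_def by (simp add: algebra_simps)
  qed
  ultimately have puu: "p u u = 0"
    by (simp add: LIMSEQ_const_iff)
  then have lim: "(\<lambda>n. norm (p (s n) u)) \<longlonglongrightarrow> 0"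
    using conv tendsto_norm_zero by auto
  have "norm (p u (T u)) \<le> norm (p (s (Suc n)) u) + k * norm (p (s n) u)" for n
    using norm_triangle_p[OF u TX[OF u] sX[of "Suc n"]] contr[OF sX[of n] u]
      symmetric[OF u sX[of "Suc n"]] by (simp add: s_def)
  moreover have "(\<lambda>n. norm (p (s (Suc n)) u) + k * norm (p (s n) u)) \<longlonglongrightarrow> 0 + k * 0"
    by (intro tendsto_add tendsto_mult tendsto_const LIMSEQ_Suc[OF lim] lim)
  ultimately have "norm (p u (T u)) \<le> 0"
    using LIMSEQ_le_const by fastforce
  then have Tu: "T u = u"
    using eq_if_norm_zero[OF u TX[OF u]] by simp
  have "v = u" if "v \<in> X" "T v = v" for v
  proof -
    have "norm (p v u) \<le> k * norm (p v u)"
      using contr[OF that(1) u] that Tu by simp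
    then have "(1 - k) * norm (p v u) \<le> 0"
      by (simp add: algebra_simps)
    then have "norm (p v u) \<le> 0"
      using \<open>k < 1\<close> by (simp add: mult_le_0_iff)
    then show ?thesis
      by (rule eq_if_norm_zero[OF that(1) u])
  qed
  then show ?thesis
    using u Tu puu by blast
qed

end
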